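(* Let $n>1$, $d>1$ be integers, let $\{u_i\}_{1\le i\le d}$ and $\{v_i\}_{1\le i\le d}$ be two families of vectors of $\mathbb{R}^n$, and consider the homogeneous polynomials of degree $d$ in $n$ variables $$U(x)=\prod_{1\le i\le d}\langle x\mid u_i\rangle,\qquad V(x)=\prod_{1\le i\le d}\langle x\mid v_i\rangle .$$ Then their Bombieri scalar product is $$\langle U\mid V\rangle=\frac{1}{d!}\sum_{\sigma\in S_d}\ \prod_{1\le i\le d}\langle u_i\mid v_{\sigma(i)}\rangle ,$$ where $S_d$ is the group of permutations of $\{1,\dots,d\}$. In particular, when both families are constant, i.e. $U(x)=\langle x\mid u\rangle^d$ and $V(x)=\langle x\mid v\rangle^d$, one has $\langle U\mid V\rangle=\langle u\mid v\rangle^d$.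
   Context: On $\mathbb{R}^n$, $\langle\cdot\mid\cdot\rangle$ is the usual Euclidean scalar product. On the space $\mathbb{R}[X_1,\dots,X_n]_d$ of real homogeneous polynomials of degree $d$, the Bombieri scalar product is defined by $\langle x^\alpha\mid x^\alpha\rangle=\alpha!/d!$ for multi-indices $\alpha\in\mathbb{N}^n$ with $|\alpha|=d$ (where $\alpha!=\prod_i\alpha_i!$), and $\langle x^\alpha\mid x^\beta\rangle=0$ if $\alpha\ne\beta$. *)

theory Defs
  imports
    "HOL-Analysis.Analysis"
    "HOL-Library.Poly_Mapping"
    "HOL-Combinatorics.Permutations"
begin

text \<open>
  The polynomial ring in the variables \<open>X\<^sub>i\<close>, \<open>i :: 'n\<close>, is the monoid algebra of the multi-indices
  \<open>'n \<Rightarrow>\<^sub>0 nat\<close>: multiplication on \<open>Poly_Mapping\<close> is convolution, so products and powers below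
  are those of formal polynomials, and \<open>lookup P \<alpha>\<close> is the coefficient of \<open>x\<^sup>\<alpha>\<close> in \<open>P\<close>.
\<close>

type_synonym 'n multi_index = "'n \<Rightarrow>\<^sub>0 nat"
type_synonym 'n real_mpoly = "'n multi_index \<Rightarrow>\<^sub>0 real"

definition mi_deg :: "'n::finite multi_index \<Rightarrow> nat"
  where "mi_deg \<alpha> = (\<Sum>i\<in>UNIV. Poly_Mapping.lookup \<alpha> i)"

definition mi_fact :: "'n::finite multi_index \<Rightarrow> real"
  where "mi_fact \<alpha> = (\<Prod>i\<in>UNIV. fact (Poly_Mapping.lookup \<alpha> i))"

definition homogeneous :: "nat \<Rightarrow> 'n::finite real_mpoly \<Rightarrow> bool"
  where "homogeneous d P \<longleftrightarrow> (\<forall>\<alpha>\<in>Poly_Mapping.keys P. mi_deg \<alpha> = d)"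

definition mpoly_eval :: "'n::finite real_mpoly \<Rightarrow> real ^ 'n \<Rightarrow> real"
  where "mpoly_eval P x = 
    (\<Sum>\<alpha>\<in>Poly_Mapping.keys P. Poly_Mapping.lookup P \<alpha> * (\<Prod>i\<in>UNIV. (x $ i) ^ Poly_Mapping.lookup \<alpha> i))"

definition lin_form :: "real ^ 'n::finite \<Rightarrow> 'n real_mpoly"
  where "lin_form u = (\<Sum>i\<in>UNIV. Poly_Mapping.single (Poly_Mapping.single i 1) (u $ i))"

text \<open>
  The bilinear form with \<open>\<langle>x\<^sup>\<alpha> | x\<^sup>\<beta>\<rangle> = (if \<alpha> = \<beta> then \<alpha>! / d! else 0)\<close> for multi-indices of degree \<open>d\<close>,
  written out in coefficients. It is meant for polynomials that are homogeneous of degree \<open>d\<close>;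
  components of other degrees are ignored.
\<close>

definition bombieri :: "nat \<Rightarrow> 'n::finite real_mpoly \<Rightarrow> 'n real_mpoly \<Rightarrow> real"
  where "bombieri d P Q =
    (\<Sum>\<alpha> | mi_deg \<alpha> = d. Poly_Mapping.lookup P \<alpha> * Poly_Mapping.lookup Q \<alpha> * (mi_fact \<alpha> / fact d))"

text \<open>The index set of the sum is finite, so the sum is not degenerate.\<close>

lemma finite_mi_deg: "finite {\<alpha> :: 'n::finite multi_index. mi_deg \<alpha> = d}"
proof -
  have le: "Poly_Mapping.lookup \<alpha> i \<le> mi_deg \<alpha>" for \<alpha> :: "'n multi_index" and i
    unfolding mi_deg_def by (rule member_le_sum) simp_all
  have "Poly_Mapping.lookup ` {\<alpha> :: 'n multi_index. mi_deg \<alpha> = d} \<subseteq> Pi\<^sub>E UNIV (\<lambda>_. {..d})"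
    using le by (auto simp: PiE_iff)
  moreover have "finite (Pi\<^sub>E (UNIV :: 'n set) (\<lambda>_. {..d}))"
    by (rule finite_PiE) simp_all
  ultimately have "finite (Poly_Mapping.lookup ` {\<alpha> :: 'n multi_index. mi_deg \<alpha> = d})"
    by (rule finite_subset)
  moreover have "inj_on Poly_Mapping.lookup {\<alpha> :: 'n multi_index. mi_deg \<alpha> = d}"
    by (rule inj_onI) (simp only: poly_mapping_eq_iff)
  ultimately show ?thesis
    by (rule finite_imageD)
qed

text \<open>
  The conditions that characterise the Bombieri scalar product: values on monomials and
  bilinearity (here together with symmetry), and positive definiteness.
\<close>

lemma bombieri_monom:
  fixes \<alpha> \<beta> :: "'n::finite multi_index"
  assumes "mi_deg \<alpha> = d" "mi_deg \<beta> = d"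
  shows "bombieri d (Poly_Mapping.single \<alpha> 1) (Poly_Mapping.single \<beta> 1) = (if \<alpha> = \<beta> then mi_fact \<alpha> / fact d else 0)"
proof -
  have "bombieri d (Poly_Mapping.single \<alpha> 1) (Poly_Mapping.single \<beta> 1)
      = (\<Sum>\<gamma> | mi_deg \<gamma> = d. if \<gamma> = \<alpha> then (if \<alpha> = \<beta> then mi_fact \<alpha> / fact d else 0) else 0)"
    unfolding bombieri_def by (rule sum.cong) (auto simp: lookup_single when_def)
  then show ?thesis
    using assms by (simp add: sum.delta' finite_mi_deg)
qed

lemma bombieri_commute: "bombieri d P Q = bombieri d Q P"
  by (simp add: bombieri_def mult.commute)

lemma bombieri_add_left: "bombieri d (P + P') Q = bombieri d P Q + bombieri d P' Q"
  by (simp add: bombieri_def lookup_add algebra_simps sum.distrib)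

lemma bombieri_scale_left: "bombieri d (Poly_Mapping.map ((*) c) P) Q = c * bombieri d P Q"
  unfolding bombieri_def sum_distrib_left
  by (rule sum.cong) (auto simp: Poly_Mapping.map.rep_eq when_def)

lemma bombieri_pos:
  assumes "homogeneous d P" "P \<noteq> 0"
  shows "bombieri d P P > 0"
proof -
  have pos: "mi_fact \<alpha> > 0" for \<alpha> :: "'a multi_index"
    by (simp add: mi_fact_def prod_pos)
  from assms(2) obtain \<alpha> where a: "\<alpha> \<in> Poly_Mapping.keys P"
    by (metis in_keys_iff lookup_zero poly_mapping_eqI)
  with assms(1) have "mi_deg \<alpha> = d" by (simp add: homogeneous_def)
  moreover have "Poly_Mapping.lookup P \<alpha> * Poly_Mapping.lookup P \<alpha> > 0"
    using a by (auto simp: in_keys_iff zero_less_mult_iff linorder_neq_iff)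
  ultimately show ?thesis
    unfolding bombieri_def using pos
    by (intro sum_pos2[where i = \<alpha>]) (auto simp: finite_mi_deg less_imp_le)
qed

text \<open>The formal linear form and its products have the expected values and degree.\<close>

lemma mpoly_eval_superset:
  assumes "finite A" "Poly_Mapping.keys P \<subseteq> A"
  shows "mpoly_eval P x = (\<Sum>\<alpha>\<in>A. Poly_Mapping.lookup P \<alpha> * (\<Prod>i\<in>UNIV. (x $ i) ^ Poly_Mapping.lookup \<alpha> i))"
  unfolding mpoly_eval_def using assms
  by (intro sum.mono_neutral_left) (auto simp: in_keys_iff)

lemma mpoly_eval_add: "mpoly_eval (P + Q) x = mpoly_eval P x + mpoly_eval Q x"
  using mpoly_eval_superset[of "Poly_Mapping.keys P \<union> Poly_Mapping.keys Q" P x] mpoly_eval_superset[of "Poly_Mapping.keys P \<union> Poly_Mapping.keys Q" Q x]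
    mpoly_eval_superset[of "Poly_Mapping.keys P \<union> Poly_Mapping.keys Q" "P + Q" x] keys_add[of P Q]
  by (simp add: lookup_add distrib_right sum.distrib)

lemma mpoly_eval_sum: "mpoly_eval (\<Sum>i\<in>A. f i) x = (\<Sum>i\<in>A. mpoly_eval (f i) x)"
  by (induction A rule: infinite_finite_induct) (simp_all add: mpoly_eval_add, simp_all add: mpoly_eval_def)

lemma mpoly_eval_single: "mpoly_eval (Poly_Mapping.single \<alpha> c) x = c * (\<Prod>i\<in>UNIV. (x $ i) ^ Poly_Mapping.lookup \<alpha> i)"
  by (simp add: mpoly_eval_def)

lemma real_mpoly_decompose: "P = (\<Sum>\<alpha>\<in>Poly_Mapping.keys P. Poly_Mapping.single \<alpha> (Poly_Mapping.lookup P \<alpha>))" for P :: "'n real_mpoly"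
  by (rule poly_mapping_eqI) (auto simp: lookup_sum lookup_single when_def in_keys_iff)

lemma mpoly_eval_mult: "mpoly_eval (P * Q) x = mpoly_eval P x * mpoly_eval Q x"
proof -
  have "P * Q = (\<Sum>\<alpha>\<in>Poly_Mapping.keys P. Poly_Mapping.single \<alpha> (Poly_Mapping.lookup P \<alpha>))
      * (\<Sum>\<beta>\<in>Poly_Mapping.keys Q. Poly_Mapping.single \<beta> (Poly_Mapping.lookup Q \<beta>))"
    by (rule arg_cong2[where f = "(*)"]; rule real_mpoly_decompose)
  also have "\<dots> = (\<Sum>\<alpha>\<in>Poly_Mapping.keys P. \<Sum>\<beta>\<in>Poly_Mapping.keys Q.
      Poly_Mapping.single (\<alpha> + \<beta>) (Poly_Mapping.lookup P \<alpha> * Poly_Mapping.lookup Q \<beta>))"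
    by (simp add: sum_product mult_single)
  finally have "mpoly_eval (P * Q) x = (\<Sum>\<alpha>\<in>Poly_Mapping.keys P. \<Sum>\<beta>\<in>Poly_Mapping.keys Q.
      mpoly_eval (Poly_Mapping.single (\<alpha> + \<beta>) (Poly_Mapping.lookup P \<alpha> * Poly_Mapping.lookup Q \<beta>)) x)"
    by (simp add: mpoly_eval_sum)
  then show ?thesis
    by (simp add: mpoly_eval_single lookup_add power_add prod.distrib)
      (simp add: mpoly_eval_def sum_product ac_simps)
qed

lemma mpoly_eval_lin_form: "mpoly_eval (lin_form u) x = x \<bullet> u"
proof -
  have "(\<Prod>j\<in>UNIV. (x $ j) ^ Poly_Mapping.lookup (Poly_Mapping.single i (1::nat)) j) = x $ i" for i
  proof -
    have "(\<Prod>j\<in>UNIV. (x $ j) ^ Poly_Mapping.lookup (Poly_Mapping.single i (1::nat)) j) = (\<Prod>j\<in>UNIV. if j = i then x $ j else 1)"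
      by (rule prod.cong) (auto simp: lookup_single when_def)
    then show ?thesis by simp
  qed
  then show ?thesis
    by (simp add: lin_form_def mpoly_eval_sum mpoly_eval_single inner_vec_def mult.commute)
qed

lemma mpoly_eval_prod_lin_form:
  fixes d :: nat
  shows "mpoly_eval (\<Prod>i\<in>{1..d}. lin_form (u i)) x = (\<Prod>i\<in>{1..d}. x \<bullet> u i)"
proof -
  have "mpoly_eval 1 x = 1"
    using mpoly_eval_single[of 0 1 x] by simp
  then show ?thesis
    by (induction d) (simp_all add: mpoly_eval_mult mpoly_eval_lin_form)
qed

lemma homogeneous_prod_lin_form: "homogeneous d (\<Prod>i\<in>{1..d}. lin_form (u i))"
proof (induction d)
  case 0
  show ?case by (simp add: homogeneous_def mi_deg_def)
next
  case (Suc d)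
  have "homogeneous 1 (lin_form (u (Suc d)))"
    unfolding homogeneous_def lin_form_def
    by (auto dest!: subsetD[OF keys_sum] simp: mi_deg_def lookup_single when_def split: if_splits)
  with Suc show ?case
    unfolding homogeneous_def
    by (fastforce dest!: subsetD[OF keys_mult] simp: mi_deg_def lookup_add sum.distrib)
qed

end

theory Submission
  imports Defs
begin

text \<open>
  Expanding both products into monomials indexed by maps \<open>f, g\<close> from the factors to the variables
  reduces the claim to the count of the permutations \<open>\<sigma>\<close> with \<open>f = g \<circ> \<sigma>\<close>: there are
  \<open>\<alpha>!\<close> of them if \<open>f\<close> and \<open>g\<close> yield the same monomial \<open>x\<^sup>\<alpha>\<close>, and none otherwise.
\<close>

text \<open>The exponent of the monomial obtained by picking the variable \<open>f i\<close> from
  each factor \<open>i\<close>. The index set is arbitrary so that induction can add one factor at a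
  time.\<close>

definition monom_exp :: "'i set \<Rightarrow> ('i \<Rightarrow> 'n) \<Rightarrow> 'n::finite multi_index"
  where "monom_exp I f = (\<Sum>i\<in>I. Poly_Mapping.single (f i) 1)"

lemma lookup_monom_exp:
  assumes "finite I"
  shows "Poly_Mapping.lookup (monom_exp I f) k = card {i\<in>I. f i = k}"
proof -
  have "Poly_Mapping.lookup (monom_exp I f) k = (\<Sum>i\<in>I. if f i = k then 1 else 0)"
    by (simp add: monom_exp_def lookup_sum lookup_single when_def cong: if_cong)
  also have "\<dots> = card {i\<in>I. f i = k}"
    using assms by (simp add: sum.If_cases Int_def)
  finally show ?thesis .
qed

lemma mi_deg_monom_exp: "mi_deg (monom_exp I f) = card I"
proof -
  have "mi_deg (monom_exp I f) = (\<Sum>i\<in>I. \<Sum>k\<in>UNIV. if f i = k then 1 else 0)"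
    unfolding mi_deg_def monom_exp_def lookup_sum
    by (subst sum.swap) (simp add: lookup_single when_def)
  then show ?thesis by simp
qed

lemma monom_exp_insert:
  assumes "finite I" "a \<notin> I"
  shows "monom_exp (insert a I) f = Poly_Mapping.single (f a) 1 + monom_exp I f"
  using assms by (simp add: monom_exp_def)

lemma monom_exp_comp_permutes:
  assumes "\<sigma> permutes I"
  shows "monom_exp I (f \<circ> \<sigma>) = monom_exp I f"
  using sum.permute[OF assms, of "\<lambda>i. Poly_Mapping.single (f i) (1::nat)"]
  by (simp add: monom_exp_def o_def)

text \<open>Only the factor at \<open>k\<close> changes, by (m+1)! = (m+1) m!. The count of matching
  permutations obeys the same recursion.\<close>

lemma mi_fact_single_add:
  "mi_fact (Poly_Mapping.single k 1 + \<alpha>) = real (Poly_Mapping.lookup \<alpha> k + 1) * mi_fact \<alpha>"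
proof -
  have "mi_fact (Poly_Mapping.single k 1 + \<alpha>)
      = (\<Prod>i\<in>UNIV. (if i = k then real (Poly_Mapping.lookup \<alpha> k + 1) else 1) * fact (Poly_Mapping.lookup \<alpha> i))"
    unfolding mi_fact_def by (rule prod.cong) (auto simp: lookup_add lookup_single when_def)
  then show ?thesis
    by (simp add: prod.distrib mi_fact_def)
qed

text \<open>Induction on \<open>I\<close>, sorting the permutations by the image \<open>b\<close> of
  the new point \<open>a\<close>. The induction hypothesis is applied to \<open>g\<close> composed
  with a transposition, so \<open>g\<close> must stay arbitrary.\<close>

lemma sum_permutes_matching:
  fixes f g :: "'i \<Rightarrow> 'n::finite"
  assumes "finite I"
  shows "(\<Sum>\<sigma> | \<sigma> permutes I. \<Prod>i\<in>I. of_bool (f i = g (\<sigma> i)))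
       = (if monom_exp I f = monom_exp I g then mi_fact (monom_exp I f) else 0)"
  using assms
proof (induction I arbitrary: g)
  case empty
  then show ?case by (simp add: monom_exp_def mi_fact_def)
next
  case (insert a I)
  let ?\<tau> = "\<lambda>b. Transposition.transpose a b"
  let ?m = "mi_fact (monom_exp I f)"
  \<comment> \<open>Swapping \<open>a\<close> and \<open>b\<close> keeps the monomial of
    \<open>g\<close> and brings the value \<open>g b\<close> to position \<open>a\<close>, where it
    can be split off.\<close>
  have split: "monom_exp (insert a I) g = Poly_Mapping.single (g b) 1 + monom_exp I (g \<circ> ?\<tau> b)"
    if "b \<in> insert a I" for b
  proof -
    have "monom_exp (insert a I) g = monom_exp (insert a I) (g \<circ> ?\<tau> b)"
      using that by (intro monom_exp_comp_permutes[symmetric] permutes_swap_id) auto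
    then show ?thesis
      using insert.hyps by (simp add: monom_exp_insert)
  qed
  have "(\<Sum>\<sigma> | \<sigma> permutes insert a I. \<Prod>i\<in>insert a I. of_bool (f i = g (\<sigma> i)) :: real)
      = (\<Sum>b\<in>insert a I. \<Sum>\<sigma> | \<sigma> permutes I. \<Prod>i\<in>insert a I. of_bool (f i = g ((?\<tau> b \<circ> \<sigma>) i)))"
    using insert.hyps by (rule sum_over_permutations_insert)
  \<comment> \<open>Since \<open>\<sigma>\<close> fixes \<open>a\<close>, the composed permutation
    sends \<open>a\<close> to \<open>b\<close>, so the factor at \<open>a\<close> depends on
    \<open>b\<close> alone.\<close>
  also have "\<dots> = (\<Sum>b\<in>insert a I. of_bool (f a = g b) *
      (\<Sum>\<sigma> | \<sigma> permutes I. \<Prod>i\<in>I. of_bool (f i = (g \<circ> ?\<tau> b) (\<sigma> i))))"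
    unfolding sum_distrib_left using insert.hyps
    by (intro sum.cong refl) (simp add: permutes_not_in)
  also have "\<dots> = (\<Sum>b\<in>insert a I. of_bool (f a = g b) *
      (if monom_exp I f = monom_exp I (g \<circ> ?\<tau> b) then ?m else 0))"
    by (simp only: insert.IH)
  \<comment> \<open>If \<open>g b = f a\<close>, cancelling the common summand makes the two
    conditions equivalent; otherwise both sides vanish. The condition no longer involves
    \<open>b\<close>, so only the number of admissible \<open>b\<close> remains to be found.\<close>
  also have "\<dots> = (\<Sum>b\<in>insert a I. of_bool (g b = f a) *
      (if monom_exp (insert a I) f = monom_exp (insert a I) g then ?m else 0))"
  proof (intro sum.cong refl)
    fix b assume "b \<in> insert a I"
    from split[OF this]
    show "of_bool (f a = g b) * (if monom_exp I f = monom_exp I (g \<circ> ?\<tau> b) then ?m else 0)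
       = of_bool (g b = f a) * (if monom_exp (insert a I) f = monom_exp (insert a I) g then ?m else 0)"
      by (simp add: monom_exp_insert[OF insert.hyps, of f])
  qed
  also have "\<dots> = real (Poly_Mapping.lookup (monom_exp (insert a I) g) (f a)) *
      (if monom_exp (insert a I) f = monom_exp (insert a I) g then ?m else 0)"
    using insert.hyps
    by (simp only: lookup_monom_exp finite_insert sum_distrib_right[symmetric] sum_of_bool_eq) (simp add: Int_def)
  also have "\<dots> = (if monom_exp (insert a I) f = monom_exp (insert a I) g
      then mi_fact (monom_exp (insert a I) f) else 0)"
  proof (cases "monom_exp (insert a I) f = monom_exp (insert a I) g")
    case True
    \<comment> \<open>Hence the number of admissible \<open>b\<close> is one more than the exponent
      of \<open>f a\<close> in \<open>monom_exp I f\<close>, the factor in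
      \<open>mi_fact_single_add\<close>.\<close>
    have "monom_exp (insert a I) g = Poly_Mapping.single (f a) 1 + monom_exp I f"
      using True monom_exp_insert[OF insert.hyps, of f] by simp
    then show ?thesis
      using True by (simp add: mi_fact_single_add[unfolded One_nat_def] lookup_add)
  qed simp
  finally show ?case .
qed

lemma prod_poly_mapping_single:
  "(\<Prod>i\<in>I. Poly_Mapping.single (\<alpha> i) (c i)) = Poly_Mapping.single (\<Sum>i\<in>I. \<alpha> i) (\<Prod>i\<in>I. c i)"
  for \<alpha> :: "'i \<Rightarrow> 'a::comm_monoid_add" and c :: "'i \<Rightarrow> 'b::comm_semiring_1"
  by (induction I rule: infinite_finite_induct) (simp_all add: mult_single)

text \<open>Distributivity, without collecting equal monomials. Using \<open>Pi\<^sub>E\<close>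
  makes every choice of variables on \<open>I\<close> occur exactly once.\<close>

lemma prod_lin_form_expand:
  assumes "finite I"
  shows "(\<Prod>i\<in>I. lin_form (u i))
       = (\<Sum>f\<in>Pi\<^sub>E I (\<lambda>_. UNIV). Poly_Mapping.single (monom_exp I f) (\<Prod>i\<in>I. u i $ f i))"
  unfolding lin_form_def
  using assms by (simp add: prod_sum_PiE prod_poly_mapping_single monom_exp_def)

lemma bombieri_sum_left: "bombieri d (\<Sum>i\<in>A. P i) Q = (\<Sum>i\<in>A. bombieri d (P i) Q)"
  by (induction A rule: infinite_finite_induct)
    (simp_all add: bombieri_add_left, simp_all add: bombieri_def)

lemma bombieri_sum_right: "bombieri d P (\<Sum>i\<in>A. Q i) = (\<Sum>i\<in>A. bombieri d P (Q i))"
  by (simp add: bombieri_commute[of d P] bombieri_sum_left)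

text \<open>The conditional is kept as a separate factor in the shape of the right-hand side of
  \<open>sum_permutes_matching\<close>.\<close>

lemma bombieri_single:
  assumes "mi_deg \<alpha> = d"
  shows "bombieri d (Poly_Mapping.single \<alpha> r) (Poly_Mapping.single \<beta> s)
       = r * s * (if \<alpha> = \<beta> then mi_fact \<alpha> else 0) / fact d"
proof -
  have "bombieri d (Poly_Mapping.single \<alpha> r) (Poly_Mapping.single \<beta> s)
      = (\<Sum>\<gamma> | mi_deg \<gamma> = d. if \<gamma> = \<alpha> then r * s * (if \<alpha> = \<beta> then mi_fact \<alpha> else 0) / fact d else 0)"
    unfolding bombieri_def by (rule sum.cong) (auto simp: lookup_single when_def)
  then show ?thesis
    using assms by (simp add: finite_mi_deg)
qed

text \<open>For fixed \<open>f\<close> the indicators force \<open>g\<close> to be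
  \<open>f \<circ> inv \<sigma>\<close> on \<open>I\<close>; the remaining sum over \<open>f\<close>
  factors into scalar products.\<close>

lemma sum_PiE_permutes:
  fixes u v :: "'i \<Rightarrow> real ^ 'n::finite"
  assumes "finite I" and \<sigma>: "\<sigma> permutes I"
  shows "(\<Sum>f\<in>Pi\<^sub>E I (\<lambda>_. UNIV). \<Sum>g\<in>Pi\<^sub>E I (\<lambda>_. UNIV).
      (\<Prod>i\<in>I. u i $ f i) * (\<Prod>i\<in>I. v i $ g i) * (\<Prod>i\<in>I. of_bool (f i = g (\<sigma> i))))
    = (\<Prod>i\<in>I. u i \<bullet> v (\<sigma> i))"
proof -
  have inner: "(\<Sum>g\<in>Pi\<^sub>E I (\<lambda>_. UNIV). (\<Prod>i\<in>I. v i $ g i) * (\<Prod>i\<in>I. of_bool (f i = g (\<sigma> i))))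
      = (\<Prod>i\<in>I. v (\<sigma> i) $ f i)" for f
  proof -
    \<comment> \<open>Reindexing by \<open>j = \<sigma> i\<close> lets the factor at
      \<open>j\<close> depend on \<open>g\<close> only through \<open>g j\<close>, so the sum over
      \<open>g\<close> becomes a product of sums.\<close>
    have "(\<Prod>i\<in>I. of_bool (f i = g (\<sigma> i)) :: real) = (\<Prod>j\<in>I. of_bool (f (inv \<sigma> j) = g j))" for g
      using prod.permute[OF \<sigma>, of "\<lambda>j. of_bool (f (inv \<sigma> j) = g j) :: real"]
      by (simp add: o_def permutes_inverses(2)[OF \<sigma>])
    then have "(\<Sum>g\<in>Pi\<^sub>E I (\<lambda>_. UNIV). (\<Prod>i\<in>I. v i $ g i) * (\<Prod>i\<in>I. of_bool (f i = g (\<sigma> i))))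
        = (\<Sum>g\<in>Pi\<^sub>E I (\<lambda>_. UNIV). \<Prod>j\<in>I. v j $ g j * of_bool (f (inv \<sigma> j) = g j))"
      by (simp add: prod.distrib)
    also have "\<dots> = (\<Prod>j\<in>I. \<Sum>k\<in>UNIV. v j $ k * of_bool (f (inv \<sigma> j) = k))"
      using assms by (subst prod_sum_PiE) auto
    also have "\<dots> = (\<Prod>j\<in>I. v j $ f (inv \<sigma> j))"
      by (simp add: of_bool_def if_distrib cong: if_cong)
    also have "\<dots> = (\<Prod>i\<in>I. v (\<sigma> i) $ f i)"
      using prod.permute[OF \<sigma>, of "\<lambda>j. v j $ f (inv \<sigma> j)"]
      by (simp add: o_def permutes_inverses(2)[OF \<sigma>])
    finally show ?thesis .
  qed
  have "(\<Prod>i\<in>I. u i \<bullet> v (\<sigma> i)) = (\<Sum>f\<in>Pi\<^sub>E I (\<lambda>_. UNIV). \<Prod>i\<in>I. u i $ f i * v (\<sigma> i) $ f i)"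
    unfolding inner_vec_def using assms by (simp add: prod_sum_PiE)
  then show ?thesis
    by (simp add: inner prod.distrib mult.assoc sum_distrib_left[symmetric])
qed

theorem bombieri_prod_lin_form:
  fixes u v :: "'i \<Rightarrow> real ^ 'n::finite"
  assumes "finite I"
  shows "bombieri (card I) (\<Prod>i\<in>I. lin_form (u i)) (\<Prod>i\<in>I. lin_form (v i))
       = 1 / fact (card I) * (\<Sum>\<sigma> | \<sigma> permutes I. \<Prod>i\<in>I. u i \<bullet> v (\<sigma> i))"
proof -
  let ?F = "Pi\<^sub>E I (\<lambda>_. UNIV :: 'n set)"
  let ?c = "\<lambda>f g. (\<Prod>i\<in>I. u i $ f i) * (\<Prod>i\<in>I. v i $ g i)"
  have "bombieri (card I) (\<Prod>i\<in>I. lin_form (u i)) (\<Prod>i\<in>I. lin_form (v i))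
      = (\<Sum>f\<in>?F. \<Sum>g\<in>?F. ?c f g *
          (if monom_exp I f = monom_exp I g then mi_fact (monom_exp I f) else 0) / fact (card I))"
    unfolding prod_lin_form_expand[OF assms] bombieri_sum_left
    unfolding bombieri_sum_right bombieri_single[OF mi_deg_monom_exp] ..
  \<comment> \<open>The count is read backwards: the factorial becomes a sum over permutations,
    which the next two exchanges move outermost.\<close>
  also have "\<dots> = 1 / fact (card I) * (\<Sum>f\<in>?F. \<Sum>g\<in>?F. \<Sum>\<sigma> | \<sigma> permutes I.
      ?c f g * (\<Prod>i\<in>I. of_bool (f i = g (\<sigma> i))))"
    unfolding sum_permutes_matching[OF assms, symmetric] sum_distrib_left sum_divide_distrib
    by simp
  also have "(\<Sum>f\<in>?F. \<Sum>g\<in>?F. \<Sum>\<sigma> | \<sigma> permutes I. ?c f g * (\<Prod>i\<in>I. of_bool (f i = g (\<sigma> i))))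
      = (\<Sum>f\<in>?F. \<Sum>\<sigma> | \<sigma> permutes I. \<Sum>g\<in>?F. ?c f g * (\<Prod>i\<in>I. of_bool (f i = g (\<sigma> i))))"
    by (rule sum.cong[OF refl], rule sum.swap)
  also have "\<dots> = (\<Sum>\<sigma> | \<sigma> permutes I. \<Sum>f\<in>?F. \<Sum>g\<in>?F. ?c f g * (\<Prod>i\<in>I. of_bool (f i = g (\<sigma> i))))"
    by (rule sum.swap)
  also have "\<dots> = (\<Sum>\<sigma> | \<sigma> permutes I. \<Prod>i\<in>I. u i \<bullet> v (\<sigma> i))"
    by (rule sum.cong[OF refl]) (simp only: mem_Collect_eq sum_PiE_permutes[OF assms])
  finally show ?thesis .
qed

theorem lemma4p2:
  fixes d :: nat and u v :: "nat \<Rightarrow> real ^ 'n::finite" and a b :: "real ^ 'n"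
  assumes "CARD('n) > 1" and "d > 1"
  shows "bombieri d (\<Prod>i\<in>{1..d}. lin_form (u i)) (\<Prod>i\<in>{1..d}. lin_form (v i))
           = 1 / fact d * (\<Sum>\<sigma> | \<sigma> permutes {1..d}. \<Prod>i\<in>{1..d}. u i \<bullet> v (\<sigma> i))
       \<and> bombieri d (lin_form a ^ d) (lin_form b ^ d) = (a \<bullet> b) ^ d"
proof
  show "bombieri d (\<Prod>i\<in>{1..d}. lin_form (u i)) (\<Prod>i\<in>{1..d}. lin_form (v i))
      = 1 / fact d * (\<Sum>\<sigma> | \<sigma> permutes {1..d}. \<Prod>i\<in>{1..d}. u i \<bullet> v (\<sigma> i))"
    using bombieri_prod_lin_form[of "{1..d}" u v] by simp
  \<comment> \<open>For constant families each of the d! permutations contributes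
    \<open>(a \<bullet> b) ^ d\<close>, which cancels the factor 1/d!.\<close>
  show "bombieri d (lin_form a ^ d) (lin_form b ^ d) = (a \<bullet> b) ^ d"
    using bombieri_prod_lin_form[of "{1..d}" "\<lambda>_. a" "\<lambda>_. b"] card_permutations[of "{1..d}" d]
    by simp
qed

end
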